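(* The set $\{\beta\phi\restriction\omega^* : \phi\colon\omega\to\omega \text{ is injective}\}$ is dense in $C_k(\omega^*,\omega^* )$.
   Context: $\omega$ carries the discrete topology, $\beta\omega$ is its Stone–Čech compactification and $\omega^*=\beta\omega\setminus\omega$ is the remainder. For an injective (more generally finite-to-one) map $\phi\colon\omega\to\omega$, the Stone–Čech extension $\beta\phi\colon\beta\omega\to\beta\omega$ restricts to a continuous map $\omega^*\to\omega^*$; this restriction is identified with $\beta\phi$ in the paper. $C_k(X,Y)$ denotes the set of continuous functions $X\to Y$ with the compact-open topology, generated by the subbasis of sets $[C,U]=\{f : f(C)\subseteq U\}$ with $C\subseteq X$ compact and $U\subseteq Y$ open. *)

theory Defs
  imports "HOL-Analysis.Analysis"
begin

section \<open>Ultrafilters\<close>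

definition ultrafilter :: "'a filter \<Rightarrow> bool" where
  "ultrafilter F \<longleftrightarrow> F \<noteq> bot \<and> (\<forall>P. eventually P F \<or> eventually (\<lambda>x. \<not> P x) F)"

lemma ultrafilter_eventually_not:
  assumes "ultrafilter F"
  shows "eventually (\<lambda>x. \<not> P x) F \<longleftrightarrow> \<not> eventually P F"
proof
  assume n: "eventually (\<lambda>x. \<not> P x) F"
  show "\<not> eventually P F"
  proof
    assume "eventually P F"
    with n have "eventually (\<lambda>x. False) F"
      by eventually_elim auto
    then show False
      using assms by (simp add: ultrafilter_def trivial_limit_def)
  qed
qed (use assms in \<open>auto simp: ultrafilter_def\<close>)

lemma ultrafilter_principal_singleton: "ultrafilter (principal {x})"
  by (simp add: ultrafilter_def eventually_principal principal_eq_bot_iff)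

lemma ultrafilter_filtermap: "ultrafilter F \<Longrightarrow> ultrafilter (filtermap f F)"
  by (simp add: ultrafilter_def eventually_filtermap filtermap_bot_iff)

lemma ultrafilter_contains_finite_cover:
  assumes F: "ultrafilter F" and "finite I" and "eventually (\<lambda>x. \<exists>i\<in>I. P i x) F"
  shows "\<exists>i\<in>I. eventually (P i) F"
proof (rule ccontr)
  assume "\<not> (\<exists>i\<in>I. eventually (P i) F)"
  then have "\<forall>i\<in>I. eventually (\<lambda>x. \<not> P i x) F"
    using ultrafilter_eventually_not[OF F] by blast
  then have "eventually (\<lambda>x. \<forall>i\<in>I. \<not> P i x) F"
    using \<open>finite I\<close> by (simp add: eventually_ball_finite_distrib)
  then have "eventually (\<lambda>x. \<not> (\<exists>i\<in>I. P i x)) F"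
    by (simp)
  then show False
    using assms(3) ultrafilter_eventually_not[OF F] by blast
qed

text \<open>Every family of sets with the finite intersection property lies in an ultrafilter.\<close>

lemma ultrafilter_exists:
  fixes \<A> :: "'a set set"
  assumes fip: "\<And>\<F>. finite \<F> \<Longrightarrow> \<F> \<subseteq> \<A> \<Longrightarrow> \<Inter>\<F> \<noteq> {}"
  shows "\<exists>F. ultrafilter F \<and> (\<forall>A\<in>\<A>. eventually (\<lambda>x. x \<in> A) F)"
proof -
  define fp :: "'a set set \<Rightarrow> bool"
    where "fp = (\<lambda>\<M>. \<forall>\<F>. finite \<F> \<and> \<F> \<subseteq> \<M> \<longrightarrow> \<Inter>\<F> \<noteq> {})"
  have "\<exists>\<M>\<in>{\<M>. \<A> \<subseteq> \<M> \<and> fp \<M>}. \<forall>X\<in>{\<M>. \<A> \<subseteq> \<M> \<and> fp \<M>}. \<M> \<subseteq> X \<longrightarrow> X = \<M>"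
  proof (rule subset_Zorn_nonempty)
    show "{\<M>. \<A> \<subseteq> \<M> \<and> fp \<M>} \<noteq> {}"
      using fip by (auto simp: fp_def)
  next
    fix \<C> assume ne: "\<C> \<noteq> {}" and ch: "subset.chain {\<M>. \<A> \<subseteq> \<M> \<and> fp \<M>} \<C>"
    have "fp (\<Union>\<C>)"
      unfolding fp_def
    proof (intro allI impI)
      fix \<F> assume f: "finite \<F> \<and> \<F> \<subseteq> \<Union>\<C>"
      then obtain \<M> where "\<M> \<in> \<C>" "\<F> \<subseteq> \<M>"
        using finite_subset_Union_chain[of \<F> \<C>] ne ch by blast
      then show "\<Inter>\<F> \<noteq> {}"
        using f ch by (auto simp: subset.chain_def fp_def)
    qed
    moreover have "\<A> \<subseteq> \<Union>\<C>"
      using ne ch unfolding subset.chain_def by fastforce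
    ultimately show "\<Union>\<C> \<in> {\<M>. \<A> \<subseteq> \<M> \<and> fp \<M>}"
      by simp
  qed
  then obtain \<M> where sub: "\<A> \<subseteq> \<M>" and fp: "fp \<M>"
    and max: "\<And>X. fp X \<Longrightarrow> \<M> \<subseteq> X \<Longrightarrow> X = \<M>"
    by (metis (mono_tags, lifting) mem_Collect_eq subset_trans)
  have mem: "A \<in> \<M>"
    if "\<And>\<F>. finite \<F> \<Longrightarrow> \<F> \<subseteq> \<M> \<Longrightarrow> A \<inter> \<Inter>\<F> \<noteq> {}" for A
  proof -
    have "fp (insert A \<M>)"
      unfolding fp_def
    proof (intro allI impI)
      fix \<F> assume "finite \<F> \<and> \<F> \<subseteq> insert A \<M>"
      then have "A \<inter> \<Inter>(\<F> - {A}) \<noteq> {}"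
        using that[of "\<F> - {A}"] by auto
      then show "\<Inter>\<F> \<noteq> {}" by blast
    qed
    then show ?thesis using max by blast
  qed
  define F where "F = (INF A\<in>\<M>. principal A)"
  have inF: "eventually (\<lambda>x. x \<in> A) F" if "A \<in> \<M>" for A
    unfolding F_def by (rule eventually_INF1[OF that]) (simp add: eventually_principal)
  have "F \<noteq> bot"
    unfolding F_def
  proof (rule INF_filter_not_bot)
    fix X assume X: "X \<subseteq> \<M>" "finite X"
    then have "(INF A\<in>X. principal A) = principal (\<Inter>X)"
      using INF_principal_finite[of X "\<lambda>A. A"] by simp
    then show "(INF A\<in>X. principal A) \<noteq> bot"
      using X fp by (simp add: principal_eq_bot_iff fp_def)
  qed
  moreover have "eventually P F \<or> eventually (\<lambda>x. \<not> P x) F" for P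
  proof (cases "{x. P x} \<in> \<M>")
    case True
    then show ?thesis using inF by force
  next
    case False
    then obtain \<F> where \<F>: "finite \<F>" "\<F> \<subseteq> \<M>" "{x. P x} \<inter> \<Inter>\<F> = {}"
      using mem[of "{x. P x}"] by metis
    have "eventually (\<lambda>x. \<forall>A\<in>\<F>. x \<in> A) F"
      using \<F> inF by (auto simp: eventually_ball_finite_distrib)
    then have "eventually (\<lambda>x. \<not> P x) F"
      by (rule eventually_mono) (use \<F>(3) in blast)
    then show ?thesis ..
  qed
  ultimately show ?thesis
    using inF sub by (auto simp: ultrafilter_def)
qed

section \<open>The Stone--Cech compactification of \<open>\<omega>\<close> and its remainder\<close>

text \<open>
  The compactification is realised as the space of ultrafilters on \<^typ>\<open>nat\<close>, where \<open>n\<close> is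
  identified with the principal ultrafilter at \<open>n\<close>.  That this is the Stone--Cech
  compactification of the discrete space \<open>\<omega>\<close> is the content of the theorems
  \<open>compact_space_beta_omega\<close>, \<open>Hausdorff_space_beta_omega\<close>, \<open>embedding_map_beta_omega\<close>,
  \<open>dense_beta_omega\<close> and \<open>stone_cech_property\<close> below.
\<close>

definition beta_omega :: "nat filter topology" where
  "beta_omega =
     topology_generated_by (range (\<lambda>A. {F. ultrafilter F \<and> eventually (\<lambda>n. n \<in> A) F}))"

definition omega_pt :: "nat \<Rightarrow> nat filter" where
  "omega_pt n = principal {n}"

definition omega_star :: "nat filter topology" where
  "omega_star = subtopology beta_omega (topspace beta_omega - range omega_pt)"

lemma topspace_beta_omega: "topspace beta_omega = {F. ultrafilter F}"
proof -
  have "{F. ultrafilter F \<and> eventually (\<lambda>n. n \<in> (UNIV::nat set)) F} = {F. ultrafilter F}"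
    by simp
  then show ?thesis
    unfolding beta_omega_def topology_generated_by_topspace by blast
qed

lemma topspace_omega_star: "topspace omega_star = {F. ultrafilter F} - range omega_pt"
  by (auto simp: omega_star_def topspace_beta_omega)

lemma openin_beta_omega_basic:
  "openin beta_omega {F. ultrafilter F \<and> eventually (\<lambda>n. n \<in> A) F}"
  unfolding beta_omega_def by (rule topology_generated_by_Basis) blast

lemma openin_beta_omega:
  "openin beta_omega W \<longleftrightarrow>
     W \<subseteq> {F. ultrafilter F} \<and>
     (\<forall>F\<in>W. \<exists>A. eventually (\<lambda>n. n \<in> A) F \<and>
        {G. ultrafilter G \<and> eventually (\<lambda>n. n \<in> A) G} \<subseteq> W)" (is "?l \<longleftrightarrow> ?r")
proof
  assume W: ?l
  then have sub: "W \<subseteq> {F. ultrafilter F}"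
    using openin_subset topspace_beta_omega by blast
  have "\<exists>A. eventually (\<lambda>n. n \<in> A) F \<and> {G. ultrafilter G \<and> eventually (\<lambda>n. n \<in> A) G} \<subseteq> V"
    if "generate_topology_on (range (\<lambda>A. {F. ultrafilter F \<and> eventually (\<lambda>n. n \<in> A) F})) V"
      and "F \<in> V" for F V
    using that
  proof (induction rule: generate_topology_on.induct)
    case Empty
    then show ?case by simp
  next
    case (Int a b)
    then obtain A B where "eventually (\<lambda>n. n \<in> A) F" "eventually (\<lambda>n. n \<in> B) F"
      "{G. ultrafilter G \<and> eventually (\<lambda>n. n \<in> A) G} \<subseteq> a"
      "{G. ultrafilter G \<and> eventually (\<lambda>n. n \<in> B) G} \<subseteq> b"
      by auto
    then show ?case
      by (intro exI[of _ "A \<inter> B"]) (auto simp: eventually_conj_iff)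
  next
    case (UN K)
    then show ?case by (meson Union_iff Union_upper order_trans)
  next
    case (Basis s)
    then show ?case by auto
  qed
  moreover have "generate_topology_on
      (range (\<lambda>A. {F. ultrafilter F \<and> eventually (\<lambda>n. n \<in> A) F})) W"
    using W unfolding beta_omega_def by (simp only: openin_topology_generated_by_iff)
  ultimately show ?r
    using sub by blast
next
  assume ?r
  then show ?l
    by (subst openin_subopen) (use openin_beta_omega_basic in blast)
qed

lemma omega_pt_in_beta_omega: "omega_pt n \<in> topspace beta_omega"
  by (simp add: omega_pt_def topspace_beta_omega ultrafilter_principal_singleton)

lemma eventually_omega_pt: "eventually P (omega_pt n) \<longleftrightarrow> P n"
  by (simp add: omega_pt_def eventually_principal)

theorem Hausdorff_space_beta_omega: "Hausdorff_space beta_omega"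
  unfolding Hausdorff_space_def
proof (intro allI impI, elim conjE)
  fix F G assume "F \<in> topspace beta_omega" "G \<in> topspace beta_omega" and ne: "F \<noteq> G"
  then have F: "ultrafilter F" and G: "ultrafilter G"
    by (auto simp: topspace_beta_omega)
  obtain P where P: "eventually P F" "\<not> eventually P G"
    using ne ultrafilter_eventually_not[OF F] ultrafilter_eventually_not[OF G]
    by (metis filter_eq_iff)
  let ?U = "\<lambda>A. {F. ultrafilter F \<and> eventually (\<lambda>n. n \<in> A) F}"
  have "disjnt (?U {n. P n}) (?U {n. \<not> P n})"
    by (auto simp: disjnt_def ultrafilter_eventually_not)
  moreover have "F \<in> ?U {n. P n}" "G \<in> ?U {n. \<not> P n}"
    using P F G ultrafilter_eventually_not[OF G] by auto
  ultimately show "\<exists>U V. openin beta_omega U \<and> openin beta_omega V \<and> F \<in> U \<and> G \<in> V \<and> disjnt U V"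
    using openin_beta_omega_basic by blast
qed

theorem compact_space_beta_omega: "compact_space beta_omega"
  unfolding compact_space_alt
proof (intro allI impI, elim conjE)
  fix \<U> assume op: "Ball \<U> (openin beta_omega)" and cov: "topspace beta_omega \<subseteq> \<Union>\<U>"
  let ?U = "\<lambda>A. {F. ultrafilter F \<and> eventually (\<lambda>n. n \<in> A) F}"
  define \<A> where "\<A> = {A. \<exists>U\<in>\<U>. ?U A \<subseteq> U}"
  have "\<exists>\<F>. finite \<F> \<and> \<F> \<subseteq> uminus ` \<A> \<and> \<Inter>\<F> = {}"
  proof (rule ccontr)
    assume "\<not> ?thesis"
    then obtain F where F: "ultrafilter F" "\<forall>A\<in>uminus ` \<A>. eventually (\<lambda>x. x \<in> A) F"
      using ultrafilter_exists[of "uminus ` \<A>"] by metis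
    then obtain U where "U \<in> \<U>" "F \<in> U"
      using cov by (auto simp: topspace_beta_omega)
    then obtain A where A: "eventually (\<lambda>n. n \<in> A) F" "A \<in> \<A>"
      using op by (auto simp: openin_beta_omega \<A>_def Ball_def) blast
    with F have "eventually (\<lambda>n. \<not> n \<in> A) F"
      by auto
    with A F show False
      using ultrafilter_eventually_not by blast
  qed
  then obtain \<B> where \<B>: "finite \<B>" "\<B> \<subseteq> \<A>" and emp: "\<Inter>(uminus ` \<B>) = {}"
    by (metis finite_subset_image)
  obtain f where f: "\<And>A. A \<in> \<B> \<Longrightarrow> f A \<in> \<U> \<and> ?U A \<subseteq> f A"
    using \<B>(2) unfolding \<A>_def subset_eq mem_Collect_eq by metis
  have "topspace beta_omega \<subseteq> \<Union>(f ` \<B>)"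
  proof
    fix F assume "F \<in> topspace beta_omega"
    then have F: "ultrafilter F" by (simp add: topspace_beta_omega)
    have "\<exists>A\<in>\<B>. n \<in> A" for n using emp by blast
    then have "\<exists>A\<in>\<B>. eventually (\<lambda>n. n \<in> A) F"
      by (intro ultrafilter_contains_finite_cover[OF F \<B>(1)]) simp
    then show "F \<in> \<Union>(f ` \<B>)" using f F by blast
  qed
  moreover have "f ` \<B> \<subseteq> \<U>" using f by blast
  ultimately show "\<exists>\<F>. finite \<F> \<and> \<F> \<subseteq> \<U> \<and> topspace beta_omega \<subseteq> \<Union>\<F>"
    using \<B>(1) by (intro exI[of _ "f ` \<B>"]) blast
qed

theorem dense_beta_omega: "beta_omega closure_of (range omega_pt) = topspace beta_omega"
proof -
  have "range omega_pt \<inter> W \<noteq> {}" if W: "openin beta_omega W" "W \<noteq> {}" for W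
  proof -
    obtain F A where "F \<in> W" "eventually (\<lambda>n. n \<in> A) F" "ultrafilter F"
      and sub: "{G. ultrafilter G \<and> eventually (\<lambda>n. n \<in> A) G} \<subseteq> W"
      using W unfolding openin_beta_omega by blast
    then have "A \<noteq> {}"
      by (auto simp: ultrafilter_def)
    then obtain n where "n \<in> A" by blast
    then have "omega_pt n \<in> W"
      using sub omega_pt_in_beta_omega[of n]
      by (auto simp: topspace_beta_omega eventually_omega_pt)
    then show ?thesis by blast
  qed
  then show ?thesis
    by (simp add: dense_intersects_open)
qed

theorem embedding_map_beta_omega:
  "embedding_map (discrete_topology UNIV) beta_omega omega_pt"
proof -
  have "open_map (discrete_topology UNIV) beta_omega omega_pt"
    unfolding open_map_def
  proof (intro allI impI)
    fix S :: "nat set"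
    have "{G. ultrafilter G \<and> eventually (\<lambda>x. x = n) G} = {omega_pt n}" for n
    proof -
      have "G = omega_pt n" if "ultrafilter G" "eventually (\<lambda>x. x = n) G" for G
      proof (rule filter_eqI)
        fix P
        have "eventually P G" if "P n" for P
          using \<open>eventually (\<lambda>x. x = n) G\<close> by (rule eventually_mono) (use that in simp)
        then show "eventually P G = eventually P (omega_pt n)"
          using ultrafilter_eventually_not[OF \<open>ultrafilter G\<close>]
          by (metis eventually_omega_pt)
      qed
      then show ?thesis
        by (auto simp: omega_pt_def eventually_principal ultrafilter_principal_singleton)
    qed
    then have "openin beta_omega {omega_pt n}" for n
      using openin_beta_omega_basic[of "{n}"] by simp
    then have "openin beta_omega (\<Union>n\<in>S. {omega_pt n})"
      by blast
    then show "openin beta_omega (omega_pt ` S)"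
      by (simp add: UNION_singleton_eq_range)
  qed
  moreover have "continuous_map (discrete_topology UNIV) beta_omega omega_pt"
    using omega_pt_in_beta_omega by simp
  moreover have "inj omega_pt"
    by (auto simp: inj_def omega_pt_def)
  ultimately show ?thesis
    by (simp add: injective_open_imp_embedding_map)
qed

theorem stone_cech_property:
  fixes g :: "nat \<Rightarrow> 'b"
  assumes Y: "compact_space Y" "Hausdorff_space Y" and g: "range g \<subseteq> topspace Y"
  shows "\<exists>!h. h \<in> extensional (topspace beta_omega) \<and> continuous_map beta_omega Y h \<and>
              (\<forall>n. h (omega_pt n) = g n)"
proof (rule ex_ex1I)
  have lim: "\<exists>y. limitin Y g y F" if F: "ultrafilter F" for F
  proof (rule ccontr)
    assume no: "\<not> ?thesis"
    have "\<exists>U. openin Y U \<and> y \<in> U \<and> \<not> eventually (\<lambda>n. g n \<in> U) F" if "y \<in> topspace Y" for y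
      using no that unfolding limitin_def by blast
    then obtain u where u: "\<And>y. y \<in> topspace Y \<Longrightarrow>
        openin Y (u y) \<and> y \<in> u y \<and> \<not> eventually (\<lambda>n. g n \<in> u y) F"
      by metis
    have "topspace Y \<subseteq> \<Union>(u ` topspace Y)" "\<forall>U\<in>u ` topspace Y. openin Y U"
      using u by blast+
    then obtain \<F> where "finite \<F>" "\<F> \<subseteq> u ` topspace Y" and cov: "topspace Y \<subseteq> \<Union>\<F>"
      using Y(1)[unfolded compact_space_alt, rule_format, of "u ` topspace Y"] by blast
    moreover have "\<exists>U\<in>\<F>. eventually (\<lambda>n. g n \<in> U) F"
    proof (rule ultrafilter_contains_finite_cover[OF F \<open>finite \<F>\<close>])
      have "\<exists>U\<in>\<F>. g n \<in> U" for n using cov g by blast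
      then show "eventually (\<lambda>n. \<exists>U\<in>\<F>. g n \<in> U) F" by simp
    qed
    ultimately show False using u by blast
  qed
  then obtain l where l: "\<And>F. ultrafilter F \<Longrightarrow> limitin Y g (l F) F"
    by metis
  define h where "h = restrict l (topspace beta_omega)"
  have hlim: "limitin Y g (h F) F" if "ultrafilter F" for F
    using l[OF that] that by (simp add: h_def topspace_beta_omega)
  have "continuous_map beta_omega Y h"
    unfolding continuous_map_def
  proof (intro conjI allI impI)
    show "h \<in> topspace beta_omega \<rightarrow> topspace Y"
      using hlim by (auto simp: topspace_beta_omega limitin_def)
  next
    fix U assume U: "openin Y U"
    show "openin beta_omega {F \<in> topspace beta_omega. h F \<in> U}"
      unfolding openin_beta_omega
    proof (intro conjI ballI)
      fix F assume "F \<in> {F \<in> topspace beta_omega. h F \<in> U}"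
      then have F: "ultrafilter F" and hF: "h F \<in> U"
        by (auto simp: topspace_beta_omega)
      have "regular_space Y"
        using Y by (simp add: compact_Hausdorff_imp_regular_space)
      then obtain V C where VC: "openin Y V" "closedin Y C" "h F \<in> V" "V \<subseteq> C" "C \<subseteq> U"
        using U hF unfolding neighbourhood_base_of_closedin[symmetric] neighbourhood_base_of
        by metis
      have "h G \<in> U" if G: "ultrafilter G" "eventually (\<lambda>n. n \<in> g -` V) G" for G
      proof (rule ccontr)
        assume "h G \<notin> U"
        then have "h G \<in> topspace Y - C" "openin Y (topspace Y - C)"
          using VC hlim[OF G(1)] by (auto simp: limitin_def)
        then have "eventually (\<lambda>n. g n \<in> topspace Y - C) G"
          using hlim[OF G(1)] by (auto simp: limitin_def)
        with G(2) have "eventually (\<lambda>n. False) G"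
          by eventually_elim (use VC in auto)
        then show False using G(1) by (simp add: ultrafilter_def trivial_limit_def)
      qed
      moreover have "eventually (\<lambda>n. n \<in> g -` V) F"
        using hlim[OF F] VC by (auto simp: limitin_def)
      ultimately show "\<exists>A. eventually (\<lambda>n. n \<in> A) F \<and>
          {G. ultrafilter G \<and> eventually (\<lambda>n. n \<in> A) G} \<subseteq> {F \<in> topspace beta_omega. h F \<in> U}"
        by (intro exI[of _ "g -` V"]) (auto simp: topspace_beta_omega)
    qed (auto simp: topspace_beta_omega)
  qed
  moreover have "h (omega_pt n) = g n" for n
  proof -
    have "limitin Y g (g n) (omega_pt n)"
      using g by (auto simp: limitin_def eventually_omega_pt)
    moreover have "limitin Y g (h (omega_pt n)) (omega_pt n)"
      using hlim by (simp add: omega_pt_def ultrafilter_principal_singleton)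
    moreover have "omega_pt n \<noteq> bot"
      by (simp add: omega_pt_def principal_eq_bot_iff)
    ultimately show ?thesis
      using limitin_Hausdorff_unique[OF _ _ _ Y(2)] by metis
  qed
  moreover have "h \<in> extensional (topspace beta_omega)"
    by (simp add: h_def)
  ultimately show "\<exists>h. h \<in> extensional (topspace beta_omega) \<and> continuous_map beta_omega Y h \<and>
              (\<forall>n. h (omega_pt n) = g n)"
    by blast
next
  fix h k
  assume h: "h \<in> extensional (topspace beta_omega) \<and> continuous_map beta_omega Y h \<and>
              (\<forall>n. h (omega_pt n) = g n)"
    and k: "k \<in> extensional (topspace beta_omega) \<and> continuous_map beta_omega Y k \<and>
              (\<forall>n. k (omega_pt n) = g n)"
  have "h F = k F" if "F \<in> topspace beta_omega" for F
    by (rule forall_in_closure_of_eq[of F beta_omega "range omega_pt" Y h k])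
      (use that h k Y dense_beta_omega in auto)
  then show "h = k"
    using h k by (auto intro: extensionalityI)
qed

text \<open>
  The map \<open>\<beta>\<phi>\<close> is the continuous extension of \<open>\<phi>\<close>, viewed as a map from \<open>\<omega>\<close> into \<open>\<beta>\<omega>\<close>.
  In the ultrafilter model it pushes ultrafilters forward along \<open>\<phi>\<close> (theorem
  \<open>beta_map_eq_filtermap\<close>).
\<close>

definition beta_map :: "(nat \<Rightarrow> nat) \<Rightarrow> nat filter \<Rightarrow> nat filter" where
  "beta_map \<phi> = (THE h. h \<in> extensional (topspace beta_omega) \<and>
      continuous_map beta_omega beta_omega h \<and> (\<forall>n. h (omega_pt n) = omega_pt (\<phi> n)))"

theorem beta_map_eq_filtermap: "beta_map \<phi> = restrict (filtermap \<phi>) (topspace beta_omega)"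
proof -
  have cont: "continuous_map beta_omega beta_omega (filtermap \<phi>)"
    unfolding continuous_map_def
  proof (intro conjI allI impI)
    show "filtermap \<phi> \<in> topspace beta_omega \<rightarrow> topspace beta_omega"
      by (simp add: topspace_beta_omega ultrafilter_filtermap)
  next
    fix U assume U: "openin beta_omega U"
    show "openin beta_omega {F \<in> topspace beta_omega. filtermap \<phi> F \<in> U}"
      unfolding openin_beta_omega
    proof (intro conjI ballI)
      fix F assume "F \<in> {F \<in> topspace beta_omega. filtermap \<phi> F \<in> U}"
      then obtain A where "eventually (\<lambda>n. n \<in> A) (filtermap \<phi> F)"
        "{G. ultrafilter G \<and> eventually (\<lambda>n. n \<in> A) G} \<subseteq> U"
        using U unfolding openin_beta_omega by blast
      then show "\<exists>A. eventually (\<lambda>n. n \<in> A) F \<and> {G. ultrafilter G \<and> eventually (\<lambda>n. n \<in> A) G}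
            \<subseteq> {F \<in> topspace beta_omega. filtermap \<phi> F \<in> U}"
        by (intro exI[of _ "\<phi> -` A"])
          (auto simp: eventually_filtermap topspace_beta_omega ultrafilter_filtermap subset_eq)
    qed (auto simp: topspace_beta_omega)
  qed
  have "range (\<lambda>n. omega_pt (\<phi> n)) \<subseteq> topspace beta_omega"
    using omega_pt_in_beta_omega by blast
  note uniq = stone_cech_property[OF compact_space_beta_omega Hausdorff_space_beta_omega this]
  show ?thesis
    unfolding beta_map_def
  proof (rule the1_equality[OF uniq], intro conjI allI)
    show "continuous_map beta_omega beta_omega (restrict (filtermap \<phi>) (topspace beta_omega))"
      using cont by (simp add: continuous_map_eq)
  qed (use omega_pt_in_beta_omega in \<open>auto simp: omega_pt_def\<close>)
qed

section \<open>The compact-open topology\<close>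

text \<open>
  Maps between the topological spaces \<open>X\<close> and \<open>Y\<close> are represented by functions that take the
  value \<^const>\<open>undefined\<close> outside \<^term>\<open>topspace X\<close>, so that equality of representatives is
  equality of maps.
\<close>

definition continuous_maps :: "'a topology \<Rightarrow> 'b topology \<Rightarrow> ('a \<Rightarrow> 'b) set" where
  "continuous_maps X Y = {f \<in> extensional (topspace X). continuous_map X Y f}"

definition compact_open_topology :: "'a topology \<Rightarrow> 'b topology \<Rightarrow> ('a \<Rightarrow> 'b) topology" where
  "compact_open_topology X Y = topology_generated_by
     {{f \<in> continuous_maps X Y. f ` C \<subseteq> U} | C U. compactin X C \<and> openin Y U}"

lemma topspace_compact_open_topology:
  "topspace (compact_open_topology X Y) = continuous_maps X Y"
proof -
  have "continuous_maps X Y \<in>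
     {{f \<in> continuous_maps X Y. f ` C \<subseteq> U} | C U. compactin X C \<and> openin Y U}"
    by (rule CollectI, rule exI[of _ "{}"], rule exI[of _ "{}"]) auto
  then show ?thesis
    unfolding compact_open_topology_def topology_generated_by_topspace by blast
qed

end

theory Submission
  imports Defs
begin

text \<open>
  A continuous self-map \<open>f\<close> of \<open>\<omega>\<^sup>*\<close> pulls clopen sets back to clopen sets, and the clopen subsets of
  the compact space \<open>\<omega>\<^sup>*\<close> are exactly the sets \<open>A\<^sup>*\<close> of free ultrafilters containing some
  \<open>A \<subseteq> \<omega>\<close>.  If \<open>f\<close> lies in a subbasic set \<open>[C, U]\<close>, then compactness of \<open>f(C)\<close> gives some \<open>B\<close> with
  \<open>f(C) \<subseteq> B\<^sup>* \<subseteq> U\<close> (\<open>compactin_star_between\<close>); with \<open>f\<^sup>-\<^sup>1(B\<^sup>*) = A\<^sup>*\<close>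
  (\<open>continuous_map_star_preimage\<close>) every map that takes \<open>A\<^sup>*\<close> into \<open>B\<^sup>*\<close> is in \<open>[C, U]\<close>.  So a
  neighbourhood of \<open>f\<close> is controlled by finitely many pairs \<open>(A\<^sub>i, B\<^sub>i)\<close>, and it suffices to
  find an injective \<open>\<phi>\<close> that maps \<open>A\<^sub>i\<close> into \<open>B\<^sub>i\<close> up to finitely many points, for each \<open>i\<close>.

  Preimages commute with Boolean operations, so, up to finitely many points, \<open>f\<^sup>-\<^sup>1\<close> takes each
  atom of the algebra generated by the \<open>B\<^sub>i\<close> to the atom with the same sign pattern of the
  algebra generated by the \<open>A\<^sub>i\<close>.  An infinite atom on the side
  of the \<open>A\<^sub>i\<close> lies in a free ultrafilter, whose image under \<open>f\<close> is a free ultrafilter containing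
  the corresponding atom on the side of the \<open>B\<^sub>i\<close>, so that atom is infinite as well.
  Hence a greedy choice of distinct values maps every infinite atom into its counterpart; the
  finitely many points in finite atoms are invisible in \<open>\<omega>\<^sup>*\<close> and may go anywhere
  (\<open>inj_matching_infinite_fibres\<close>).
\<close>

section \<open>Free ultrafilters\<close>

text \<open>Ultrafilters are minimal among the proper filters, in the order where finer filters are smaller.\<close>

lemma ultrafilter_minimal:
  assumes F: "ultrafilter F" and G: "G \<le> F" "G \<noteq> bot"
  shows "G = F"
proof (rule filter_eqI)
  fix P
  have "eventually P F" if "eventually P G"
  proof (rule ccontr)
    assume "\<not> eventually P F"
    then have "eventually (\<lambda>x. \<not> P x) G"
      using ultrafilter_eventually_not[OF F] G(1) by (blast intro: filter_leD)
    with that have "eventually (\<lambda>x. False) G"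
      by eventually_elim simp
    then show False
      using G(2) by (simp add: trivial_limit_def)
  qed
  then show "eventually P G = eventually P F"
    using G(1) by (blast intro: filter_leD)
qed

lemma in_omega_star_iff: "F \<in> topspace omega_star \<longleftrightarrow> ultrafilter F \<and> F \<le> cofinite"
proof (cases "ultrafilter F")
  case True
  have "F \<le> cofinite \<longleftrightarrow> F \<notin> range omega_pt"
  proof
    assume le: "F \<le> cofinite"
    show "F \<notin> range omega_pt"
    proof
      assume "F \<in> range omega_pt"
      then obtain k where k: "F = omega_pt k" ..
      have "eventually (\<lambda>n. n \<noteq> k) F"
        using le by (rule filter_leD) (simp add: eventually_cofinite)
      then show False
        by (simp add: k eventually_omega_pt)
    qed
  next
    assume free: "F \<notin> range omega_pt"
    have ne: "eventually (\<lambda>n. n \<noteq> k) F" for k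
    proof (rule ccontr)
      assume "\<not> ?thesis"
      then have "eventually (\<lambda>n. n = k) F"
        using ultrafilter_eventually_not[OF True, of "\<lambda>n. n = k"] by simp
      then have "F \<le> omega_pt k"
        by (simp add: omega_pt_def le_principal)
      then have "F = omega_pt k"
        using True ultrafilter_minimal ultrafilter_principal_singleton
        unfolding omega_pt_def ultrafilter_def by metis
      then show False using free by simp
    qed
    show "F \<le> cofinite"
    proof (rule filter_leI)
      fix P :: "nat \<Rightarrow> bool" assume "eventually P cofinite"
      then have "finite {k. \<not> P k}"
        by (simp add: eventually_cofinite)
      then have "eventually (\<lambda>n. \<forall>k\<in>{k. \<not> P k}. n \<noteq> k) F"
        using ne by (intro eventually_ball_finite) auto
      then show "eventually P F"
        by (rule eventually_mono) auto
    qed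
  qed
  then show ?thesis
    by (simp add: topspace_omega_star True)
qed (simp add: topspace_omega_star)

lemma infinite_if_eventually_free:
  assumes "F \<in> topspace omega_star" and "eventually (\<lambda>n. n \<in> A) F"
  shows "infinite A"
proof
  assume "finite A"
  then have "eventually (\<lambda>n. n \<notin> A) F"
    using assms(1) by (intro filter_leD[of F cofinite]) (auto simp: in_omega_star_iff eventually_cofinite)
  then show False
    using assms by (simp add: in_omega_star_iff ultrafilter_eventually_not)
qed

text \<open>Removing finitely many finite sets from an infinite set leaves it nonempty.\<close>

lemma free_ultrafilter_exists:
  assumes "infinite A"
  obtains F where "F \<in> topspace omega_star" and "eventually (\<lambda>n. n \<in> A) F"
proof -
  have fip: "\<Inter>\<F> \<noteq> {}" if \<F>: "finite \<F>" "\<F> \<subseteq> (\<lambda>X. A - X) ` Collect finite" for \<F>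
  proof -
    obtain \<X> where \<X>: "\<X> \<subseteq> Collect finite" "finite \<X>" "\<F> = (\<lambda>X. A - X) ` \<X>"
      using \<F> by (metis finite_subset_image)
    then have "finite (\<Union>\<X>)"
      by auto
    then have "infinite (A - \<Union>\<X>)"
      using assms by simp
    then have "A - \<Union>\<X> \<noteq> {}"
      by fastforce
    then show ?thesis
      using \<X>(3) by blast
  qed
  obtain F where F: "ultrafilter F"
    and ev: "\<And>X. finite X \<Longrightarrow> eventually (\<lambda>n. n \<in> A - X) F"
    using ultrafilter_exists[of "(\<lambda>X. A - X) ` Collect finite"] fip by auto
  have "F \<le> cofinite"
  proof (rule filter_leI)
    fix P :: "nat \<Rightarrow> bool" assume "eventually P cofinite"
    then show "eventually P F"
      using ev[of "{n. \<not> P n}"] by (auto simp: eventually_cofinite elim: eventually_mono)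
  qed
  then show thesis
    using that[of F] F ev[of "{}"] by (simp add: in_omega_star_iff)
qed

section \<open>Clopen subsets of the remainder\<close>

definition star :: "nat set \<Rightarrow> nat filter set" where
  "star A = {F \<in> topspace omega_star. eventually (\<lambda>n. n \<in> A) F}"

lemma openin_star: "openin omega_star (star A)"
proof -
  have "star A = {F. ultrafilter F \<and> eventually (\<lambda>n. n \<in> A) F} \<inter>
      (topspace beta_omega - range omega_pt)"
    by (auto simp: star_def topspace_omega_star topspace_beta_omega)
  then show ?thesis
    unfolding omega_star_def openin_subtopology using openin_beta_omega_basic by blast
qed

lemma star_base:
  assumes "openin omega_star W" "F \<in> W"
  obtains A where "F \<in> star A" "star A \<subseteq> W"
proof -
  obtain V where V: "openin beta_omega V" "W = V \<inter> (topspace beta_omega - range omega_pt)"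
    using assms(1) by (auto simp: omega_star_def openin_subtopology)
  then obtain A where "eventually (\<lambda>n. n \<in> A) F"
    "{G. ultrafilter G \<and> eventually (\<lambda>n. n \<in> A) G} \<subseteq> V"
    using assms(2) unfolding openin_beta_omega by blast
  then have "F \<in> star A" "star A \<subseteq> W"
    using assms V(2) by (auto simp: star_def topspace_omega_star topspace_beta_omega)
  then show thesis ..
qed

lemma star_Union:
  assumes "finite \<A>"
  shows "star (\<Union>\<A>) = \<Union>(star ` \<A>)"
proof
  show "star (\<Union>\<A>) \<subseteq> \<Union>(star ` \<A>)"
    using ultrafilter_contains_finite_cover[OF _ assms, of _ "\<lambda>A n. n \<in> A"]
    by (auto simp: star_def topspace_omega_star)
next
  have "eventually (\<lambda>n. n \<in> \<Union>\<A>) F" if "A \<in> \<A>" "eventually (\<lambda>n. n \<in> A) F" for A F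
    using that(2) by (rule eventually_mono) (use that(1) in blast)
  then show "\<Union>(star ` \<A>) \<subseteq> star (\<Union>\<A>)"
    by (auto simp: star_def)
qed

lemma star_Compl: "star (- A) = topspace omega_star - star A"
  by (auto simp: star_def topspace_omega_star ultrafilter_eventually_not)

text \<open>The points \<open>omega_pt n\<close> are isolated, so \<open>\<omega>\<^sup>*\<close> is closed in \<open>\<beta>\<omega>\<close>.\<close>

lemma compact_space_omega_star: "compact_space omega_star"
proof -
  have "openin beta_omega (range omega_pt)"
  proof -
    have "\<exists>A. eventually (\<lambda>m. m \<in> A) (omega_pt n) \<and>
        {G. ultrafilter G \<and> eventually (\<lambda>m. m \<in> A) G} \<subseteq> range omega_pt" for n
    proof (intro exI[of _ "{n}"] conjI subsetI)
      fix G assume G: "G \<in> {G. ultrafilter G \<and> eventually (\<lambda>m. m \<in> {n}) G}"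
      then have "G \<notin> topspace omega_star"
        using infinite_if_eventually_free[of G "{n}"] by auto
      then show "G \<in> range omega_pt"
        using G by (simp add: topspace_omega_star)
    qed (simp add: eventually_omega_pt)
    then show ?thesis
      using omega_pt_in_beta_omega unfolding openin_beta_omega topspace_beta_omega by blast
  qed
  then have "closedin beta_omega (topspace beta_omega - range omega_pt)"
    by (simp add: closedin_diff)
  then show ?thesis
    unfolding omega_star_def
    by (simp add: closedin_compact_space compact_space_beta_omega compact_space_subtopology)
qed

text \<open>
  The sets \<open>star A\<close> form a base that is closed under finite unions, so a finite subcover of a compact
  set collapses to a single basic set.
\<close>

lemma compactin_star_between:
  assumes K: "compactin omega_star K" and W: "openin omega_star W" and "K \<subseteq> W"
  obtains A where "K \<subseteq> star A" "star A \<subseteq> W"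
proof -
  have "\<exists>\<F>. finite \<F> \<and> \<F> \<subseteq> star ` {A. star A \<subseteq> W} \<and> K \<subseteq> \<Union>\<F>"
  proof (rule compactinD[OF K])
    show "K \<subseteq> \<Union>(star ` {A. star A \<subseteq> W})"
    proof
      fix F assume "F \<in> K"
      then obtain A where "F \<in> star A" "star A \<subseteq> W"
        using star_base[OF W] \<open>K \<subseteq> W\<close> by blast
      then show "F \<in> \<Union>(star ` {A. star A \<subseteq> W})" by blast
    qed
  qed (use openin_star in auto)
  then obtain \<A> where \<A>: "\<A> \<subseteq> {A. star A \<subseteq> W}" "finite \<A>" "K \<subseteq> \<Union>(star ` \<A>)"
    by (metis finite_subset_image)
  then have "K \<subseteq> star (\<Union>\<A>)" "star (\<Union>\<A>) \<subseteq> W"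
    by (auto simp: star_Union)
  then show thesis ..
qed

text \<open>
  The preimage of \<open>star B\<close> is compact and open, so a set \<open>star A\<close> fits between it and itself.
\<close>

lemma continuous_map_star_preimage:
  assumes f: "continuous_map omega_star omega_star f"
  obtains A where "\<And>F. F \<in> topspace omega_star \<Longrightarrow> f F \<in> star B \<longleftrightarrow> F \<in> star A"
proof -
  let ?W = "\<lambda>B. {F \<in> topspace omega_star. f F \<in> star B}"
  have op: "openin omega_star (?W B)" for B
    using f openin_star by (rule openin_continuous_map_preimage)
  have "?W B = topspace omega_star - ?W (- B)"
    using f by (auto simp: star_Compl continuous_map_def)
  then have "closedin omega_star (?W B)"
    using op[of "- B"] by (simp add: closedin_diff)
  then have "compactin omega_star (?W B)"
    using closedin_compact_space compact_space_omega_star by blast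
  then obtain A where "?W B \<subseteq> star A" "star A \<subseteq> ?W B"
    using compactin_star_between[OF _ op subset_refl] by blast
  then have "?W B = star A" ..
  then show thesis
    using that[of A] by (auto simp: star_def)
qed

section \<open>Maps induced by injections\<close>

lemma beta_map_omega_star: "F \<in> topspace omega_star \<Longrightarrow> beta_map \<phi> F = filtermap \<phi> F"
  by (simp add: beta_map_eq_filtermap topspace_omega_star topspace_beta_omega)

text \<open>
  Injectivity enters because it makes preimages of finite sets finite, so that images of free
  ultrafilters are free.
\<close>

lemma beta_map_in_star_iff:
  assumes "inj \<phi>" "F \<in> topspace omega_star"
  shows "beta_map \<phi> F \<in> star B \<longleftrightarrow> F \<in> star (\<phi> -` B)"
proof -
  have "filtermap \<phi> F \<le> cofinite"
  proof (rule filter_leI)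
    fix P :: "nat \<Rightarrow> bool" assume "eventually P cofinite"
    then have "finite (\<phi> -` {m. \<not> P m})"
      using \<open>inj \<phi>\<close> by (intro finite_vimageI) (auto simp: eventually_cofinite)
    then have "eventually (\<lambda>n. P (\<phi> n)) F"
      using assms(2) by (intro filter_leD[of F cofinite])
        (auto simp: in_omega_star_iff eventually_cofinite vimage_def)
    then show "eventually P (filtermap \<phi> F)"
      by (simp add: eventually_filtermap)
  qed
  then show ?thesis
    using assms(2) by (simp add: beta_map_omega_star star_def in_omega_star_iff
        ultrafilter_filtermap eventually_filtermap)
qed

lemma continuous_map_beta_map_omega_star:
  assumes "inj \<phi>"
  shows "continuous_map omega_star omega_star (beta_map \<phi>)"
  unfolding continuous_map_def
proof (intro conjI allI impI)
  have "star UNIV = topspace omega_star"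
    by (simp add: star_def)
  then show "beta_map \<phi> \<in> topspace omega_star \<rightarrow> topspace omega_star"
    using beta_map_in_star_iff[OF assms, of _ UNIV] by auto
next
  fix W assume W: "openin omega_star W"
  show "openin omega_star {F \<in> topspace omega_star. beta_map \<phi> F \<in> W}"
  proof (subst openin_subopen, intro ballI)
    fix F assume F: "F \<in> {F \<in> topspace omega_star. beta_map \<phi> F \<in> W}"
    then have "beta_map \<phi> F \<in> W" by simp
    then obtain B where B: "beta_map \<phi> F \<in> star B" "star B \<subseteq> W"
      using star_base[OF W] by blast
    have "F \<in> star (\<phi> -` B)"
      using F B(1) beta_map_in_star_iff[OF assms] by blast
    moreover have "star (\<phi> -` B) \<subseteq> {F \<in> topspace omega_star. beta_map \<phi> F \<in> W}"
    proof
      fix G assume G: "G \<in> star (\<phi> -` B)"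
      then have "G \<in> topspace omega_star" by (simp add: star_def)
      then show "G \<in> {F \<in> topspace omega_star. beta_map \<phi> F \<in> W}"
        using G B(2) beta_map_in_star_iff[OF assms] by blast
    qed
    ultimately show "\<exists>T. openin omega_star T \<and> F \<in> T \<and>
        T \<subseteq> {F \<in> topspace omega_star. beta_map \<phi> F \<in> W}"
      using openin_star by blast
  qed
qed

section \<open>Injections matching finite partitions\<close>

text \<open>Values are chosen greedily: only finitely many are used up before each step.\<close>

lemma inj_choice_infinite:
  fixes T :: "nat \<Rightarrow> 'a set"
  assumes "\<And>n. infinite (T n)"
  shows "\<exists>\<phi>. inj \<phi> \<and> (\<forall>n. \<phi> n \<in> T n)"
proof -
  have "\<exists>\<phi>. \<forall>n. \<phi> n \<in> T n \<and> \<phi> n \<notin> \<phi> ` {..<n}"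
  proof (rule dependent_wellorder_choice)
    fix n and \<phi> :: "nat \<Rightarrow> 'a"
    have "infinite (T n - \<phi> ` {..<n})"
      using assms by simp
    then show "\<exists>r. r \<in> T n \<and> r \<notin> \<phi> ` {..<n}"
      by (metis Diff_iff ex_in_conv finite.emptyI)
  qed (auto simp: image_iff)
  then obtain \<phi> where \<phi>: "\<And>n. \<phi> n \<in> T n" "\<And>n. \<phi> n \<notin> \<phi> ` {..<n}"
    by blast
  have "inj \<phi>"
    using \<phi>(2) by (intro linorder_injI) (metis imageI lessThan_iff)
  then show ?thesis
    using \<phi>(1) by blast
qed

text \<open>
  The labels \<open>s\<close> and \<open>t\<close> describe two partitions.  A point in an infinite fibre of \<open>s\<close> is sent to the
  fibre of \<open>t\<close> with the same label; the points in finite fibres are finitely many, and letting them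
  go anywhere keeps the set of allowed values infinite, which is all that injectivity needs.
\<close>

lemma inj_matching_infinite_fibres:
  fixes s :: "nat \<Rightarrow> 'c" and t :: "'a \<Rightarrow> 'c"
  assumes fin: "finite (range s)" and inf: "infinite (UNIV :: 'a set)"
    and fib: "\<And>c. infinite (s -` {c}) \<Longrightarrow> infinite (t -` {c})"
  shows "\<exists>\<phi>. inj \<phi> \<and> (\<forall>\<^sub>F n in cofinite. t (\<phi> n) = s n)"
proof -
  define T where "T n = (if infinite (s -` {s n}) then t -` {s n} else UNIV)" for n
  have "infinite (T n)" for n
    using inf fib by (simp add: T_def)
  then obtain \<phi> where \<phi>: "inj \<phi>" "\<And>n. \<phi> n \<in> T n"
    using inj_choice_infinite by blast
  have "finite (\<Union>c\<in>{c \<in> range s. finite (s -` {c})}. s -` {c})"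
    using fin by auto
  moreover have "{n. t (\<phi> n) \<noteq> s n} \<subseteq> (\<Union>c\<in>{c \<in> range s. finite (s -` {c})}. s -` {c})"
  proof
    fix n assume "n \<in> {n. t (\<phi> n) \<noteq> s n}"
    then have "finite (s -` {s n})"
      using \<phi>(2)[of n] by (auto simp: T_def split: if_splits)
    then show "n \<in> (\<Union>c\<in>{c \<in> range s. finite (s -` {c})}. s -` {c})"
      by blast
  qed
  ultimately have "\<forall>\<^sub>F n in cofinite. t (\<phi> n) = s n"
    unfolding eventually_cofinite by (rule rev_finite_subset)
  then show ?thesis
    using \<phi>(1) by blast
qed

text \<open>
  Label each point by the set of those \<open>B\<close> for which it lies in \<open>A B\<close>, respectively in \<open>B\<close>; the
  fibres of these labellings are the atoms of the two generated algebras.  The map \<open>f\<close> carries a free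
  ultrafilter on an atom of the first kind to a free ultrafilter on the atom of the second kind with
  the same label, so infinite fibres correspond to infinite fibres.\<close>

lemma inj_approximating_on_finite_family:
  assumes "finite \<B>" and f: "f \<in> topspace omega_star \<rightarrow> topspace omega_star"
    and A: "\<And>B F. B \<in> \<B> \<Longrightarrow> F \<in> topspace omega_star \<Longrightarrow> f F \<in> star B \<longleftrightarrow> F \<in> star (A B)"
  shows "\<exists>\<phi>. inj \<phi> \<and> (\<forall>B\<in>\<B>. beta_map \<phi> ` star (A B) \<subseteq> star B)"
proof -
  define s where "s n = {B \<in> \<B>. n \<in> A B}" for n
  define t where "t m = {B \<in> \<B>. m \<in> B}" for m :: nat
  have "finite (range s)"
    by (rule finite_subset[of _ "Pow \<B>"]) (auto simp: s_def \<open>finite \<B>\<close>)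
  moreover have "infinite (t -` {\<S>})" if inf: "infinite (s -` {\<S>})" for \<S>
  proof -
    obtain F where F: "F \<in> topspace omega_star" "eventually (\<lambda>n. n \<in> s -` {\<S>}) F"
      using free_ultrafilter_exists[OF inf] .
    have fF: "f F \<in> topspace omega_star"
      using f F(1) by blast
    have "s -` {\<S>} \<noteq> {}"
      using inf by (metis finite.emptyI)
    then have sub: "\<S> \<subseteq> \<B>"
      by (auto simp: s_def)
    have "eventually (\<lambda>m. m \<in> B \<longleftrightarrow> B \<in> \<S>) (f F)" if B: "B \<in> \<B>" for B
    proof (cases "B \<in> \<S>")
      case True
      have "eventually (\<lambda>n. n \<in> A B) F"
        using F(2) by (rule eventually_mono) (use True in \<open>auto simp: s_def\<close>)
      then have "f F \<in> star B"
        using A[OF B F(1)] F(1) by (simp add: star_def)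
      then show ?thesis
        using True by (simp add: star_def)
    next
      case False
      have "eventually (\<lambda>n. n \<notin> A B) F"
        using F(2) by (rule eventually_mono) (use False B in \<open>auto simp: s_def\<close>)
      then have "f F \<in> star (- B)"
        using A[OF B F(1)] F(1) fF
        by (simp add: star_Compl) (simp add: star_def topspace_omega_star ultrafilter_eventually_not)
      then show ?thesis
        using False by (simp add: star_def)
    qed
    then have "eventually (\<lambda>m. \<forall>B\<in>\<B>. m \<in> B \<longleftrightarrow> B \<in> \<S>) (f F)"
      using \<open>finite \<B>\<close> by (simp add: eventually_ball_finite)
    then have "eventually (\<lambda>m. m \<in> t -` {\<S>}) (f F)"
      by (rule eventually_mono) (use sub in \<open>auto simp: t_def\<close>)
    then show ?thesis
      using infinite_if_eventually_free fF by blast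
  qed
  ultimately obtain \<phi> where \<phi>: "inj \<phi>" "\<forall>\<^sub>F n in cofinite. t (\<phi> n) = s n"
    using inj_matching_infinite_fibres[of s t] by auto
  have "beta_map \<phi> F \<in> star B" if B: "B \<in> \<B>" and F: "F \<in> star (A B)" for B F
  proof -
    have F': "F \<in> topspace omega_star" "F \<le> cofinite"
      using F by (auto simp: star_def in_omega_star_iff)
    have "eventually (\<lambda>n. t (\<phi> n) = s n) F"
      using F'(2) \<phi>(2) by (rule filter_leD)
    moreover have "eventually (\<lambda>n. n \<in> A B) F"
      using F by (simp add: star_def)
    ultimately have "eventually (\<lambda>n. n \<in> \<phi> -` B) F"
      by eventually_elim (use B in \<open>auto simp: s_def t_def\<close>)
    then have "F \<in> star (\<phi> -` B)"
      using F'(1) by (simp add: star_def)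
    then show ?thesis
      using beta_map_in_star_iff[OF \<phi>(1) F'(1)] by blast
  qed
  then show ?thesis
    using \<phi>(1) by blast
qed

section \<open>Density\<close>

lemma topology_generated_by_finite_Inter:
  assumes "openin (topology_generated_by S) W" "x \<in> W"
  shows "\<exists>\<F>. finite \<F> \<and> \<F> \<subseteq> S \<and> x \<in> \<Inter>\<F> \<and> \<Inter>\<F> \<subseteq> W"
proof -
  have "generate_topology_on S W"
    using assms(1) by (simp only: openin_topology_generated_by_iff)
  then show ?thesis
    using assms(2)
  proof (induction rule: generate_topology_on.induct)
    case (Int a b)
    then have x: "x \<in> a" "x \<in> b"
      by simp_all
    obtain \<F> where \<F>: "finite \<F>" "\<F> \<subseteq> S" "x \<in> \<Inter>\<F>" "\<Inter>\<F> \<subseteq> a"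
      using Int.IH(1)[OF x(1)] by blast
    obtain \<G> where \<G>: "finite \<G>" "\<G> \<subseteq> S" "x \<in> \<Inter>\<G>" "\<Inter>\<G> \<subseteq> b"
      using Int.IH(2)[OF x(2)] by blast
    have "finite (\<F> \<union> \<G>)" "\<F> \<union> \<G> \<subseteq> S" "x \<in> \<Inter>(\<F> \<union> \<G>)"
      using \<F> \<G> by (auto simp only: finite_Un Un_subset_iff Inter_Un_distrib Int_iff)
    moreover have "\<Inter>(\<F> \<union> \<G>) \<subseteq> a \<inter> b"
      using \<F>(4) \<G>(4) by (simp add: Inter_Un_distrib) blast
    ultimately show ?case
      by blast
  next
    case (UN K)
    then obtain V where "V \<in> K" "x \<in> V"
      by blast
    then show ?case
      using UN.IH by (metis Union_upper order_trans)
  next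
    case (Basis s)
    then show ?case by (intro exI[of _ "{s}"]) auto
  qed simp
qed

theorem corollary5p3:
  shows "{restrict (beta_map \<phi>) (topspace omega_star) | \<phi> :: nat \<Rightarrow> nat. inj \<phi>}
           \<subseteq> topspace (compact_open_topology omega_star omega_star) \<and>
         compact_open_topology omega_star omega_star closure_of
           {restrict (beta_map \<phi>) (topspace omega_star) | \<phi> :: nat \<Rightarrow> nat. inj \<phi>}
           = topspace (compact_open_topology omega_star omega_star)"
proof -
  let ?X = omega_star
  let ?r = "\<lambda>\<phi>. restrict (beta_map \<phi>) (topspace ?X)"
  let ?D = "{?r \<phi> | \<phi> :: nat \<Rightarrow> nat. inj \<phi>}"
  let ?Y = "compact_open_topology ?X ?X"
  have r: "?r \<phi> \<in> continuous_maps ?X ?X" if "inj \<phi>" for \<phi>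
    using continuous_map_beta_map_omega_star[OF that]
    by (simp add: continuous_maps_def continuous_map_eq)
  have "?D \<inter> W \<noteq> {}" if W: "openin ?Y W" "W \<noteq> {}" for W
  proof -
    obtain f where fW: "f \<in> W"
      using W(2) by blast
    then have f: "continuous_map ?X ?X f"
      using openin_subset[OF W(1)]
      by (auto simp: topspace_compact_open_topology continuous_maps_def)
    have "\<exists>A. \<forall>F\<in>topspace ?X. f F \<in> star B \<longleftrightarrow> F \<in> star A" for B
      by (rule continuous_map_star_preimage[OF f, of B]) auto
    then obtain A where A: "\<And>B F. F \<in> topspace ?X \<Longrightarrow> f F \<in> star B \<longleftrightarrow> F \<in> star (A B)"
      by metis
    obtain \<F> where \<F>: "finite \<F>" "f \<in> \<Inter>\<F>" "\<Inter>\<F> \<subseteq> W"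
      and sub: "\<F> \<subseteq> {{g \<in> continuous_maps ?X ?X. g ` C \<subseteq> U} | C U. compactin ?X C \<and> openin ?X U}"
      using topology_generated_by_finite_Inter[OF W(1)[unfolded compact_open_topology_def] fW] by blast
    \<comment> \<open>Each subbasic condition on \<open>f\<close> is implied by one about a single pair of clopen sets.\<close>
    have "\<exists>B. \<forall>\<phi>. inj \<phi> \<and> beta_map \<phi> ` star (A B) \<subseteq> star B \<longrightarrow> ?r \<phi> \<in> N" if "N \<in> \<F>" for N
    proof -
      obtain C U where N: "N = {g \<in> continuous_maps ?X ?X. g ` C \<subseteq> U}"
        and CU: "compactin ?X C" "openin ?X U"
        using subsetD[OF sub \<open>N \<in> \<F>\<close>] by auto
      have "f ` C \<subseteq> U"
        using \<F>(2) \<open>N \<in> \<F>\<close> N by blast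
      then obtain B where B: "f ` C \<subseteq> star B" "star B \<subseteq> U"
        using compactin_star_between[OF image_compactin[OF CU(1) f] CU(2)] by blast
      have C: "C \<subseteq> topspace ?X"
        using CU(1) by (rule compactin_subset_topspace)
      have "C \<subseteq> star (A B)"
      proof
        fix F assume "F \<in> C"
        then show "F \<in> star (A B)"
          using A[of F B] B(1) C by blast
      qed
      have "?r \<phi> \<in> N" if \<phi>: "inj \<phi>" "beta_map \<phi> ` star (A B) \<subseteq> star B" for \<phi>
      proof -
        have "?r \<phi> ` C = beta_map \<phi> ` C"
          using C by (intro image_cong) auto
        also have "\<dots> \<subseteq> U"
          using \<open>C \<subseteq> star (A B)\<close> \<phi>(2) B(2) by blast
        finally show ?thesis
          using r[OF \<phi>(1)] by (simp add: N)
      qed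
      then show ?thesis by blast
    qed
    then obtain b where b: "\<And>N \<phi>. N \<in> \<F> \<Longrightarrow> inj \<phi> \<Longrightarrow>
        beta_map \<phi> ` star (A (b N)) \<subseteq> star (b N) \<Longrightarrow> ?r \<phi> \<in> N"
      by metis
    have "finite (b ` \<F>)" "f \<in> topspace ?X \<rightarrow> topspace ?X"
      using \<F>(1) f by (auto simp: continuous_map_def)
    then have "\<exists>\<phi>. inj \<phi> \<and> (\<forall>B\<in>b ` \<F>. beta_map \<phi> ` star (A B) \<subseteq> star B)"
      using A by (rule inj_approximating_on_finite_family)
    then obtain \<phi> where \<phi>: "inj \<phi>" "\<forall>B\<in>b ` \<F>. beta_map \<phi> ` star (A B) \<subseteq> star B"
      by blast
    have "?r \<phi> \<in> \<Inter>\<F>"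
    proof
      fix N assume "N \<in> \<F>"
      then show "?r \<phi> \<in> N"
        using b[OF _ \<phi>(1)] \<phi>(2) by simp
    qed
    then have "?r \<phi> \<in> W"
      using \<F>(3) by blast
    then show ?thesis
      using \<phi>(1) by blast
  qed
  then have "?Y closure_of ?D = topspace ?Y"
    by (simp add: dense_intersects_open)
  moreover have "?D \<subseteq> topspace ?Y"
    using r by (auto simp: topspace_compact_open_topology)
  ultimately show ?thesis by simp
qed

end
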